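(* For any three distinct lines $l_1,l_2,l_3$ in $\mathbb{R}^2$ and for any integer $n\ge 1$, there exist finite sets $S_1\subset l_1$, $S_2\subset l_2$, $S_3\subset l_3$, each of cardinality $\Theta(n)$, such that the number of triples $(p,q,r)\in S_1\times S_2\times S_3$ for which $p,q,r$ are the vertices of a triangle of area $1$ is $\Theta(n^2)$. (The constants implicit in the $\Theta$-notation are independent of $n$.) *)

theory Defs
  imports "HOL-Analysis.Analysis"
begin

definition is_line :: "(real^2) set \<Rightarrow> bool" where
  "is_line l \<longleftrightarrow> affine l \<and> aff_dim l = 1"

text \<open>Area is two-dimensional Lebesgue measure.  A collinear triple has area 0, so
  non-degeneracy of the triangle needs no separate condition.\<close>

definition unit_area_triples ::
    "(real^2) set \<Rightarrow> (real^2) set \<Rightarrow> (real^2) set \<Rightarrow> ((real^2) \<times> (real^2) \<times> (real^2)) set" where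
  "unit_area_triples S1 S2 S3 =
     {(p, q, r). p \<in> S1 \<and> q \<in> S2 \<and> r \<in> S3 \<and>
        measure lborel (convex hull {p, q, r}) = 1}"

end

theory Submission
  imports Defs
begin

text \<open>If points \<open>a\<^sub>i\<close>, \<open>b\<^sub>j\<close>, \<open>c\<^sub>k\<close> on the three lines satisfy
  \<open>area (a\<^sub>i, b\<^sub>j, c\<^sub>i\<^sub>+\<^sub>j) = 1\<close>, the points with \<open>i, j < n\<close> and \<open>k < 2n\<close> give at least
  \<open>n\<^sup>2\<close> unit triangles; and there are only \<open>O(n\<^sup>2)\<close> of them provided no line \<open>a\<^sub>i b\<^sub>j\<close> is parallel
  to the third line, since then \<open>a\<^sub>i\<close>, \<open>b\<^sub>j\<close> and the sign of the orientation determine \<open>c\<^sub>k\<close>.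
  In affine coordinates \<open>s, t, x\<close> along the lines, the unit area equation has an additive form
  when the lines are parallel, the multiplicative form \<open>(s - m) / (t - m) = x / (x - 1)\<close>
  when exactly two of them are, and otherwise \<open>t = (s x + w\<^sup>2) / (s + x)\<close>, which the substitution
  \<open>s = w (1 + A) / (1 - A)\<close> makes multiplicative. Geometric progressions settle the last two.\<close>

section \<open>Oriented area and symmetry in the three lines\<close>

definition cross2 :: "real^2 \<Rightarrow> real^2 \<Rightarrow> real" where
  "cross2 u v = u $ 1 * v $ 2 - u $ 2 * v $ 1"

definition line :: "real^2 \<Rightarrow> real^2 \<Rightarrow> (real^2) set" where
  "line a u = range (\<lambda>s. a + s *\<^sub>R u)"

text \<open>Bundling the whole conclusion into one predicate allows the three lines to be
  permuted.\<close>

definition has_unit_area_config :: "(real^2) set \<Rightarrow> (real^2) set \<Rightarrow> (real^2) set \<Rightarrow> bool" where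
  "has_unit_area_config l1 l2 l3 \<longleftrightarrow> (\<exists>c C :: real. 0 < c \<and> 0 < C \<and>
    (\<forall>n::nat. 1 \<le> n \<longrightarrow>
      (\<exists>S1 S2 S3. finite S1 \<and> finite S2 \<and> finite S3 \<and>
         S1 \<subseteq> l1 \<and> S2 \<subseteq> l2 \<and> S3 \<subseteq> l3 \<and>
         c * real n \<le> real (card S1) \<and> real (card S1) \<le> C * real n \<and>
         c * real n \<le> real (card S2) \<and> real (card S2) \<le> C * real n \<and>
         c * real n \<le> real (card S3) \<and> real (card S3) \<le> C * real n \<and>
         c * (real n)\<^sup>2 \<le> real (card (unit_area_triples S1 S2 S3)) \<and>
         real (card (unit_area_triples S1 S2 S3)) \<le> C * (real n)\<^sup>2)))"

lemma measure_triangle_eq_cross2: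
  fixes p q r :: "real^2"
  shows "measure lborel (convex hull {p, q, r}) = \<bar>cross2 (q - p) (r - p)\<bar> / 2"
  by (subst content_triangle) (simp add: cross2_def abs_minus_commute mult.commute)

lemma mem_unit_area_triples_iff:
  "(p, q, r) \<in> unit_area_triples S1 S2 S3 \<longleftrightarrow>
     p \<in> S1 \<and> q \<in> S2 \<and> r \<in> S3 \<and> \<bar>cross2 (q - p) (r - p)\<bar> = 2"
  by (auto simp: unit_area_triples_def measure_triangle_eq_cross2)

lemma card_unit_area_triples_swap12:
  "card (unit_area_triples S2 S1 S3) = card (unit_area_triples S1 S2 S3)"
  by (rule bij_betw_same_card[where f = "\<lambda>(p, q, r). (q, p, r)"],
      rule bij_betw_byWitness[where f' = "\<lambda>(p, q, r). (q, p, r)"])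
     (auto simp: unit_area_triples_def insert_commute)

lemma card_unit_area_triples_swap23:
  "card (unit_area_triples S1 S3 S2) = card (unit_area_triples S1 S2 S3)"
  by (rule bij_betw_same_card[where f = "\<lambda>(p, q, r). (p, r, q)"],
      rule bij_betw_byWitness[where f' = "\<lambda>(p, q, r). (p, r, q)"])
     (auto simp: unit_area_triples_def insert_commute)

text \<open>This transposition and the next one generate all permutations, so each construction may
  fix a convenient order of the lines.\<close>

lemma has_unit_area_config_swap12:
  "has_unit_area_config l1 l2 l3 \<Longrightarrow> has_unit_area_config l2 l1 l3"
  unfolding has_unit_area_config_def by (metis card_unit_area_triples_swap12)

lemma has_unit_area_config_swap23:
  "has_unit_area_config l1 l2 l3 \<Longrightarrow> has_unit_area_config l1 l3 l2"
  unfolding has_unit_area_config_def by (metis card_unit_area_triples_swap23)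

section \<open>Counting unit triangles\<close>

text \<open>As \<open>r\<close> moves along \<open>line c u\<close>, the doubled oriented area is
  affine in its parameter with slope \<open>cross2 (q - p) u\<close>. A nonzero slope leaves at most
  one \<open>r\<close> for each of the values 2 and -2.\<close>

lemma card_unit_area_triples_le:
  assumes "finite S1" "finite S2" "S3 \<subseteq> line c u"
    and nonpar: "\<And>p q. p \<in> S1 \<Longrightarrow> q \<in> S2 \<Longrightarrow> cross2 (q - p) u \<noteq> 0"
  shows "card (unit_area_triples S1 S2 S3) \<le> 2 * card S1 * card S2"
proof -
  let ?f = "\<lambda>(p, q, r). (p, q, cross2 (q - p) (r - p))"
  have determined: "r = r'"
    if S: "p \<in> S1" "q \<in> S2" "r \<in> S3" "r' \<in> S3"
      and eq: "cross2 (q - p) (r - p) = cross2 (q - p) (r' - p)" for p q r r'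
  proof -
    obtain x x' where x: "r = c + x *\<^sub>R u" "r' = c + x' *\<^sub>R u"
      using S assms(3) unfolding line_def by blast
    have "cross2 (q - p) (r - p) - cross2 (q - p) (r' - p) = (x - x') * cross2 (q - p) u"
      by (simp add: cross2_def x algebra_simps)
    then show ?thesis using eq nonpar[OF S(1,2)] x by simp
  qed
  have "inj_on ?f (unit_area_triples S1 S2 S3)"
    by (auto simp: inj_on_def unit_area_triples_def dest: determined)
  moreover have "?f ` unit_area_triples S1 S2 S3 \<subseteq> S1 \<times> S2 \<times> {2, -2}"
    by (auto simp: mem_unit_area_triples_iff)
  ultimately have "card (unit_area_triples S1 S2 S3) \<le> card (S1 \<times> S2 \<times> {2, -2 :: real})"
    using assms by (intro card_inj_on_le) auto
  then show ?thesis by (simp add: card_cartesian_product algebra_simps)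
qed

lemma has_unit_area_configI:
  fixes a b :: "nat \<Rightarrow> real^2" and \<tau> :: "nat \<Rightarrow> real"
  assumes inj: "inj a" "inj b" "inj \<tau>" and u: "u \<noteq> 0"
    and sub: "range a \<subseteq> l1" "range b \<subseteq> l2" "line c u = l3"
    and nonpar: "\<And>i j. cross2 (b j - a i) u \<noteq> 0"
    and area: "\<And>i j. \<bar>cross2 (b j - a i) (c + \<tau> (i + j) *\<^sub>R u - a i)\<bar> = 2"
  shows "has_unit_area_config l1 l2 l3"
  unfolding has_unit_area_config_def
\<comment> \<open>\<open>C = 2\<close> serves twice: \<open>S3\<close> has \<open>2 * n\<close>
  points, enough for all indices \<open>i + j\<close>, and each pair \<open>(p, q)\<close> admits
  two orientations.\<close>
proof (rule exI[of _ 1], rule exI[of _ 2], intro conjI allI impI)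
  fix n :: nat
  assume "1 \<le> n"
  define d where "d = (\<lambda>k. c + \<tau> k *\<^sub>R u)"
  have "inj d" using inj(3) u by (auto simp: d_def inj_def)
  define S1 S2 S3 where S: "S1 = a ` {..<n}" "S2 = b ` {..<n}" "S3 = d ` {..<2 * n}"
  have card: "card S1 = n" "card S2 = n" "card S3 = 2 * n"
    unfolding S using inj \<open>inj d\<close> by (auto simp: card_image inj_on_subset)
  have fin: "finite S1" "finite S2" "finite S3" by (auto simp: S)
  have line: "S3 \<subseteq> line c u" by (auto simp: S d_def line_def)
  have up: "card (unit_area_triples S1 S2 S3) \<le> 2 * card S1 * card S2"
    by (rule card_unit_area_triples_le[OF fin(1,2) line]) (auto simp: S nonpar)
  have mem: "(a i, b j, d (i + j)) \<in> unit_area_triples S1 S2 S3" if "i < n" "j < n" for i j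
  proof -
    have "a i \<in> S1" "b j \<in> S2" "d (i + j) \<in> S3" unfolding S using that by (auto intro!: imageI)
    then show ?thesis using area by (simp add: mem_unit_area_triples_iff d_def)
  qed
  have "card ({..<n} \<times> {..<n}) \<le> card (unit_area_triples S1 S2 S3)"
  proof (rule card_inj_on_le)
    show "inj_on (\<lambda>(i, j). (a i, b j, d (i + j))) ({..<n} \<times> {..<n})"
      using inj by (auto simp: inj_def inj_on_def)
    show "(\<lambda>(i, j). (a i, b j, d (i + j))) ` ({..<n} \<times> {..<n}) \<subseteq> unit_area_triples S1 S2 S3"
      using mem by auto
    have "unit_area_triples S1 S2 S3 \<subseteq> S1 \<times> S2 \<times> S3" by (auto simp: unit_area_triples_def)
    then show "finite (unit_area_triples S1 S2 S3)"
      by (rule finite_subset) (simp add: fin)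
  qed
  then have low: "n * n \<le> card (unit_area_triples S1 S2 S3)" by (simp add: card_cartesian_product)
  have "real (n * n) \<le> card (unit_area_triples S1 S2 S3)"
    "card (unit_area_triples S1 S2 S3) \<le> real (2 * n * n)"
    using low up card by (simp_all only: of_nat_le_iff)
  then show "\<exists>S1 S2 S3. finite S1 \<and> finite S2 \<and> finite S3 \<and>
         S1 \<subseteq> l1 \<and> S2 \<subseteq> l2 \<and> S3 \<subseteq> l3 \<and>
         1 * real n \<le> real (card S1) \<and> real (card S1) \<le> 2 * real n \<and>
         1 * real n \<le> real (card S2) \<and> real (card S2) \<le> 2 * real n \<and>
         1 * real n \<le> real (card S3) \<and> real (card S3) \<le> 2 * real n \<and>
         1 * (real n)\<^sup>2 \<le> real (card (unit_area_triples S1 S2 S3)) \<and>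
         real (card (unit_area_triples S1 S2 S3)) \<le> 2 * (real n)\<^sup>2"
    using fin card sub line
    by (intro exI[of _ S1] exI[of _ S2] exI[of _ S3]) (auto simp: S power2_eq_square)
qed simp_all

section \<open>Plane vectors and parametrised lines\<close>

lemma cross2_nonzeroD: "cross2 u v \<noteq> 0 \<Longrightarrow> u \<noteq> 0 \<and> v \<noteq> 0"
  by (auto simp: cross2_def)

text \<open>Cramer's rule in the plane.\<close>

lemma cross2_decompose:
  assumes "cross2 u v \<noteq> 0"
  shows "w = (cross2 w v / cross2 u v) *\<^sub>R u + (cross2 u w / cross2 u v) *\<^sub>R v"
proof -
  have "cross2 u v *\<^sub>R w = cross2 w v *\<^sub>R u + cross2 u w *\<^sub>R v"
    by (simp add: vec_eq_iff forall_2 cross2_def algebra_simps)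
  then have "(1 / cross2 u v) *\<^sub>R (cross2 u v *\<^sub>R w) =
      (1 / cross2 u v) *\<^sub>R (cross2 w v *\<^sub>R u + cross2 u w *\<^sub>R v)" by simp
  then show ?thesis using assms by (simp add: scaleR_add_right)
qed

lemma cross2_eq_0_imp_multiple:
  assumes "cross2 u v = 0" "u \<noteq> 0" "v \<noteq> 0"
  obtains k where "k \<noteq> 0" "v = k *\<^sub>R u"
proof -
  \<comment> \<open>In general the two sides differ by \<open>cross2 u v\<close> times
    \<open>u\<close> rotated by a quarter turn.\<close>
  have "(u \<bullet> u) *\<^sub>R v = (u \<bullet> v) *\<^sub>R u"
    using assms(1) by (simp add: vec_eq_iff forall_2 cross2_def inner_vec_def sum_2 algebra_simps)
  then have "(1 / (u \<bullet> u)) *\<^sub>R ((u \<bullet> u) *\<^sub>R v) = (1 / (u \<bullet> u)) *\<^sub>R ((u \<bullet> v) *\<^sub>R u)" by simp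
  then have "v = ((u \<bullet> v) / (u \<bullet> u)) *\<^sub>R u" using assms(2) by simp
  then show ?thesis using that assms(3) by (metis scaleR_zero_left)
qed

lemma line_shift: "line (a + k *\<^sub>R u) u = line a u"
proof -
  have "line (a + k *\<^sub>R u) u = (\<lambda>s. a + s *\<^sub>R u) ` range ((+) k)"
    unfolding line_def image_image by (simp add: scaleR_add_left add.assoc)
  then show ?thesis by (simp add: line_def surj_plus)
qed

lemma line_scale:
  assumes "k \<noteq> 0"
  shows "line a (k *\<^sub>R u) = line a u"
proof -
  have "line a (k *\<^sub>R u) = (\<lambda>s. a + s *\<^sub>R u) ` range (\<lambda>s. s * k)"
    unfolding line_def image_image by simp
  moreover have "range (\<lambda>s. s * k) = UNIV"
    using assms by (intro surjI[where f = "\<lambda>s. s / k"]) simp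
  ultimately show ?thesis by (simp add: line_def)
qed

lemma is_line_obtains:
  assumes "is_line l"
  obtains a u where "u \<noteq> 0" "l = line a u"
proof -
  obtain B where B: "affine hull B = affine hull l" "of_nat (card B) = aff_dim l + 1"
    using aff_dim_basis_exists by blast
  then have "card B = 2" using assms by (simp add: is_line_def)
  then obtain a b where "B = {a, b}" "a \<noteq> b" by (auto simp: card_2_iff)
  then have "l = line a (b - a)"
    using B assms affine_hull_2_alt[of a b] by (simp add: is_line_def line_def hull_same)
  then show ?thesis using that[of "b - a" a] \<open>a \<noteq> b\<close> by simp
qed

lemma lines_meet:
  assumes "cross2 u v \<noteq> 0"
  obtains p where "line p u = line a u" "line p v = line b v"
proof -
  obtain s t where st: "b - a = s *\<^sub>R u + t *\<^sub>R v" using cross2_decompose[OF assms] by blast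
  have "a + s *\<^sub>R u = b + (- t) *\<^sub>R v" using st by (simp add: algebra_simps)
  then show ?thesis using that[of "a + s *\<^sub>R u"] line_shift by metis
qed

lemma parallel_lines_neq:
  assumes "u \<noteq> 0" "line a u \<noteq> line b u"
  shows "cross2 u (b - a) \<noteq> 0"
proof
  assume "cross2 u (b - a) = 0"
  then obtain k where "b - a = k *\<^sub>R u"
    using assms cross2_eq_0_imp_multiple[of u "b - a"] by (metis scaleR_zero_left)
  then have "b = a + k *\<^sub>R u" by (simp add: algebra_simps)
  then show False using assms line_shift by metis
qed

section \<open>Configurations for the three relative positions\<close>

text \<open>The doubled oriented area is affine in the three parameters, and distinctness of the
  lines makes every coefficient nonzero. Dividing by the coefficients turns the first two terms into
  \<open>i + j\<close>, which \<open>\<tau>\<close> cancels.\<close>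

lemma config_three_parallel:
  assumes "u \<noteq> 0"
    and "line a u \<noteq> line b u" "line a u \<noteq> line c u" "line b u \<noteq> line c u"
  shows "has_unit_area_config (line a u) (line b u) (line c u)"
proof -
  define \<alpha> \<beta> \<gamma> \<delta> where d: "\<alpha> = cross2 u (b - c)" "\<beta> = cross2 u (c - a)" "\<gamma> = cross2 u (a - b)"
    "\<delta> = cross2 (b - a) (c - a)"
  have nz: "\<alpha> \<noteq> 0" "\<beta> \<noteq> 0" "\<gamma> \<noteq> 0"
    unfolding d using parallel_lines_neq assms by metis+
  have F: "cross2 ((b + t *\<^sub>R u) - (a + s *\<^sub>R u)) ((c + x *\<^sub>R u) - (a + s *\<^sub>R u)) =
      \<alpha> * s + \<beta> * t + \<gamma> * x + \<delta>" for s t x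
    by (simp add: d cross2_def algebra_simps)
  show ?thesis
  proof (rule has_unit_area_configI[where u = u and c = c
        and a = "\<lambda>i. a + (real i / \<alpha>) *\<^sub>R u" and b = "\<lambda>j. b + (real j / \<beta>) *\<^sub>R u"
        and \<tau> = "\<lambda>k. (2 - \<delta> - real k) / \<gamma>"])
    fix i j :: nat
    have "cross2 (b + (real j / \<beta>) *\<^sub>R u - (a + (real i / \<alpha>) *\<^sub>R u)) u = \<gamma>"
      by (simp add: d cross2_def algebra_simps)
    then show "cross2 (b + (real j / \<beta>) *\<^sub>R u - (a + (real i / \<alpha>) *\<^sub>R u)) u \<noteq> 0"
      using nz by simp
    show "\<bar>cross2 (b + (real j / \<beta>) *\<^sub>R u - (a + (real i / \<alpha>) *\<^sub>R u))
        (c + ((2 - \<delta> - real (i + j)) / \<gamma>) *\<^sub>R u - (a + (real i / \<alpha>) *\<^sub>R u))\<bar> = 2"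
      unfolding F using nz by simp
  qed (use nz assms in \<open>auto simp: inj_def line_def\<close>)
qed

text \<open>The transversal meets the parallels at \<open>p\<close> and \<open>p + v\<close>, that
  is, at parameters 0 and 1. This makes the area a weighted mean of \<open>s\<close> and
  \<open>t\<close> with weights \<open>1 - x\<close> and \<open>x\<close>, up to the factor
  \<open>cross2 v u\<close>.\<close>

lemma config_two_parallel:
  assumes k: "cross2 v u \<noteq> 0"
  shows "has_unit_area_config (line p v) (line (p + v) u) (line p u)"
proof -
  \<comment> \<open>With \<open>s = t = m\<close> the oriented area is 1 for every \<open>x\<close>,
    so measuring from \<open>m\<close> makes the equation homogeneous.\<close>
  define m where "m = 2 / cross2 v u"
  \<comment> \<open>Starting at 2 avoids the pole of \<open>y / (y - 1)\<close>. This map is an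
    involution, so \<open>x = y / (y - 1)\<close> gives \<open>x / (x - 1) = y\<close>.\<close>
  define y :: "nat \<Rightarrow> real" where "y = (\<lambda>i. 2 ^ Suc i)"
  have y: "y i > 1" for i by (simp add: y_def one_less_power del: power_Suc)
  have inj_y: "inj y" by (auto simp: inj_def y_def)
  have F: "cross2 ((p + v + t *\<^sub>R u) - (p + x *\<^sub>R v)) ((p + s *\<^sub>R u) - (p + x *\<^sub>R v)) =
      cross2 v u * (s * (1 - x) + t * x)" for s t x
    by (simp add: cross2_def algebra_simps)
  have uv: "u \<noteq> 0" "v \<noteq> 0" using cross2_nonzeroD[OF k] by auto
  show ?thesis
  proof (rule has_unit_area_configI[where u = u and c = p
        and a = "\<lambda>i. p + (y i / (y i - 1)) *\<^sub>R v" and b = "\<lambda>j. p + v + (m + y j) *\<^sub>R u"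
        and \<tau> = "\<lambda>k. m + 2 * y k"])
    show "inj (\<lambda>i. p + (y i / (y i - 1)) *\<^sub>R v)"
    proof (rule injI)
      fix i j assume "p + (y i / (y i - 1)) *\<^sub>R v = p + (y j / (y j - 1)) *\<^sub>R v"
      then have "y i / (y i - 1) = y j / (y j - 1)" using uv by simp
      then have "y i = y j" using y[of i] y[of j] by (simp add: field_simps)
      then show "i = j" using inj_y by (simp add: inj_def)
    qed
    fix i j :: nat
    have "cross2 (p + v + (m + y j) *\<^sub>R u - (p + (y i / (y i - 1)) *\<^sub>R v)) u =
        (1 - y i / (y i - 1)) * cross2 v u"
      by (simp add: cross2_def algebra_simps)
    also have "1 - y i / (y i - 1) = - 1 / (y i - 1)" using y[of i] by (simp add: field_simps)
    finally show "cross2 (p + v + (m + y j) *\<^sub>R u - (p + (y i / (y i - 1)) *\<^sub>R v)) u \<noteq> 0"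
      using k y[of i] by simp
    \<comment> \<open>The exponents \<open>i + 1\<close> and \<open>j + 1\<close> add up to one more
      than that of \<open>y (i + j)\<close>; hence the factor 2 in \<open>\<tau>\<close>.\<close>
    have "2 * y (i + j) = y i * y j" by (simp add: y_def power_add)
    moreover have "y i / (y i - 1) * (y i - 1) = y i" using y[of i] by simp
    ultimately have "(m + 2 * y (i + j)) * (1 - y i / (y i - 1)) + (m + y j) * (y i / (y i - 1)) = m"
      by algebra
    then show "\<bar>cross2 (p + v + (m + y j) *\<^sub>R u - (p + (y i / (y i - 1)) *\<^sub>R v))
        (p + (m + 2 * y (i + j)) *\<^sub>R u - (p + (y i / (y i - 1)) *\<^sub>R v))\<bar> = 2"
      unfolding F using k by (simp add: m_def)
  qed (use uv inj_y in \<open>auto simp: inj_def line_def\<close>)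
qed

text \<open>The lines meet at \<open>p\<close>, \<open>p + e *\<^sub>R u\<close> and
  \<open>p + e *\<^sub>R v\<close>, with \<open>e = 0\<close> when they are concurrent. Measuring
  each parameter from the midpoint of the corresponding side removes the linear terms from the area
  equation.\<close>

lemma config_pairwise_crossing_normal:
  assumes k: "cross2 u v \<noteq> 0"
  shows "has_unit_area_config (line p u) (line (p + (e / 2) *\<^sub>R (u + v)) (v - u)) (line p v)"
proof -
  text \<open>The additive constant \<open>2 / \<bar>cross2 u v\<bar>\<close> uses the freedom in the orientation of the triangle
    to make \<open>w\<^sup>2\<close> positive.\<close>
  define w where "w = sqrt (e\<^sup>2 / 4 + 2 / \<bar>cross2 u v\<bar>)"
  have w: "w > 0" "w\<^sup>2 = e\<^sup>2 / 4 + 2 / \<bar>cross2 u v\<bar>"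
    using k by (auto simp: w_def add_nonneg_pos)
  define y :: "nat \<Rightarrow> real" where "y = (\<lambda>i. 2 ^ Suc i)"
  have y: "y i > 1" for i by (simp add: y_def one_less_power del: power_Suc)
  \<comment> \<open>Writing \<open>y i\<close> as exp(2 z) gives \<open>\<phi> i\<close> = -w coth
    z. Since \<open>y i > 1\<close>, all values are negative, so \<open>\<phi> i + \<phi> j\<close>
    never vanishes and no line \<open>a b\<close> is parallel to the third.\<close>
  define \<phi> where "\<phi> = (\<lambda>i. w * (1 + y i) / (1 - y i))"
  have neg: "\<phi> i < 0" for i
    unfolding \<phi>_def using w(1) y[of i] by (intro divide_pos_neg mult_pos_pos) auto
  have inj_\<phi>: "i = j" if "\<phi> i = \<phi> j" for i j
  proof -
    have "(1 + y i) / (1 - y i) = (1 + y j) / (1 - y j)"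
      using that w(1) by (simp add: \<phi>_def flip: times_divide_eq_right)
    then have "y i = y j" using y[of i] y[of j] by (simp add: field_simps)
    then show ?thesis by (simp add: y_def)
  qed
  \<comment> \<open>This is the addition theorem of coth, proved by clearing denominators. The index
    is \<open>Suc (i + j)\<close> because \<open>y i * y j\<close> has exponent
    \<open>i + j + 2\<close>.\<close>
  have mult: "\<phi> (Suc (i + j)) * (\<phi> i + \<phi> j) - \<phi> i * \<phi> j = w\<^sup>2" for i j
  proof -
    have yy: "y (Suc (i + j)) = y i * y j" by (simp add: y_def power_add)
    have nz: "1 - y i \<noteq> 0" "1 - y j \<noteq> 0" "1 - y i * y j \<noteq> 0"
      using y[of i] y[of j] y[of "Suc (i + j)"] yy by auto
    then have "\<phi> i * (1 - y i) = w * (1 + y i)" "\<phi> j * (1 - y j) = w * (1 + y j)"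
      "\<phi> (Suc (i + j)) * (1 - y i * y j) = w * (1 + y i * y j)"
      by (simp_all add: \<phi>_def yy)
    then have "(1 - y i) * (1 - y j) * (1 - y i * y j) *
        (\<phi> (Suc (i + j)) * (\<phi> i + \<phi> j) - \<phi> i * \<phi> j - w\<^sup>2) = 0"
      by algebra
    then show ?thesis using nz by simp
  qed
  have F: "cross2 ((p + (e / 2) *\<^sub>R (u + v) + x *\<^sub>R (v - u)) - (p + (e / 2 + s) *\<^sub>R u))
      ((p + (e / 2) *\<^sub>R v + t *\<^sub>R v) - (p + (e / 2 + s) *\<^sub>R u)) =
      - cross2 u v * (t * (s + x) - s * x - e\<^sup>2 / 4)" for s t x
    by (simp add: cross2_def field_simps power2_eq_square)
  have uv: "u \<noteq> 0" "v \<noteq> 0" "v - u \<noteq> 0" using k by (auto simp: cross2_def)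
  show ?thesis
  proof (rule has_unit_area_configI[where u = v and c = "p + (e / 2) *\<^sub>R v"
        and a = "\<lambda>i. p + (e / 2 + \<phi> i) *\<^sub>R u"
        and b = "\<lambda>j. p + (e / 2) *\<^sub>R (u + v) + \<phi> j *\<^sub>R (v - u)"
        and \<tau> = "\<lambda>k. \<phi> (Suc k)"])
    fix i j :: nat
    have "cross2 (p + (e / 2) *\<^sub>R (u + v) + \<phi> j *\<^sub>R (v - u) - (p + (e / 2 + \<phi> i) *\<^sub>R u)) v =
        - (\<phi> i + \<phi> j) * cross2 u v"
      by (simp add: cross2_def algebra_simps)
    then show "cross2 (p + (e / 2) *\<^sub>R (u + v) + \<phi> j *\<^sub>R (v - u) - (p + (e / 2 + \<phi> i) *\<^sub>R u)) v \<noteq> 0"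
      using k neg[of i] neg[of j] by simp
    show "\<bar>cross2 (p + (e / 2) *\<^sub>R (u + v) + \<phi> j *\<^sub>R (v - u) - (p + (e / 2 + \<phi> i) *\<^sub>R u))
        (p + (e / 2) *\<^sub>R v + \<phi> (Suc (i + j)) *\<^sub>R v - (p + (e / 2 + \<phi> i) *\<^sub>R u))\<bar> = 2"
      unfolding F mult w(2) using k by (simp add: abs_mult)
    show "line (p + (e / 2) *\<^sub>R v) v = line p v" by (rule line_shift)
  qed (use uv inj_\<phi> in \<open>auto simp: inj_def line_def\<close>)
qed

section \<open>Reduction of arbitrary lines to these positions\<close>

lemma config_pairwise_crossing:
  assumes "cross2 u1 u2 \<noteq> 0" "cross2 u1 u3 \<noteq> 0" "cross2 u2 u3 \<noteq> 0"
  shows "has_unit_area_config (line a1 u1) (line a2 u2) (line a3 u3)"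
proof -
  obtain p where p: "line p u1 = line a1 u1" "line p u2 = line a2 u2"
    using lines_meet[OF assms(1)] by blast
  \<comment> \<open>Cramer coefficients of \<open>u3\<close> in \<open>u1\<close>,
    \<open>u2\<close>, with the sign of \<open>\<alpha>\<close> reversed so that
    \<open>u3 = v - u\<close>.\<close>
  define \<alpha> \<beta> where ab: "\<alpha> = - (cross2 u3 u2 / cross2 u1 u2)" "\<beta> = cross2 u1 u3 / cross2 u1 u2"
  have "cross2 u3 u2 = - cross2 u2 u3" by (simp add: cross2_def)
  then have nz: "\<alpha> \<noteq> 0" "\<beta> \<noteq> 0" using assms by (simp_all add: ab)
  define u v where uv: "u = \<alpha> *\<^sub>R u1" "v = \<beta> *\<^sub>R u2"
  have u3: "v - u = u3" using cross2_decompose[OF assms(1), of u3, symmetric] by (simp add: uv ab add.commute)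
  have k: "cross2 u v \<noteq> 0"
  proof -
    have "cross2 u v = \<alpha> * \<beta> * cross2 u1 u2" by (simp add: uv cross2_def algebra_simps)
    then show ?thesis using nz assms by simp
  qed
  obtain g h where gh: "a3 - p = g *\<^sub>R u + h *\<^sub>R v" using cross2_decompose[OF k] by blast
  \<comment> \<open>Along direction \<open>v - u\<close> the sum of the coordinates with respect to
    \<open>u\<close> and \<open>v\<close> stays \<open>g + h\<close>. The point with equal
    coordinates becomes the base point, and \<open>e = g + h\<close>.\<close>
  have "p + ((g + h) / 2) *\<^sub>R (u + v) = a3 + ((g - h) / 2) *\<^sub>R (v - u)"
  proof -
    have "a3 = p + g *\<^sub>R u + h *\<^sub>R v" using gh by (simp add: algebra_simps)
    then show ?thesis by (simp add: vec_eq_iff forall_2 field_simps)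
  qed
  then have "line (p + ((g + h) / 2) *\<^sub>R (u + v)) (v - u) = line a3 u3"
    by (simp only: line_shift u3)
  moreover have "line p u = line a1 u1" "line p v = line a2 u2"
    using p nz by (simp_all add: uv line_scale)
  ultimately show ?thesis
    using has_unit_area_config_swap23[OF config_pairwise_crossing_normal[OF k, of p "g + h"]] by simp
qed

lemma config_parallel_pair:
  assumes "u1 \<noteq> 0" "u2 \<noteq> 0" "u3 \<noteq> 0" and par: "cross2 u1 u2 = 0"
    and neq: "line a1 u1 \<noteq> line a2 u2" "line a1 u1 \<noteq> line a3 u3" "line a2 u2 \<noteq> line a3 u3"
  shows "has_unit_area_config (line a1 u1) (line a2 u2) (line a3 u3)"
proof -
  obtain k where "k \<noteq> 0" "u2 = k *\<^sub>R u1" using cross2_eq_0_imp_multiple[OF par assms(1,2)] .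
  then have l2: "line a2 u2 = line a2 u1" by (simp add: line_scale)
  show ?thesis
  proof (cases "cross2 u1 u3 = 0")
    case True
    then obtain k where "k \<noteq> 0" "u3 = k *\<^sub>R u1" using cross2_eq_0_imp_multiple assms(1,3) by metis
    then have "line a3 u3 = line a3 u1" by (simp add: line_scale)
    then show ?thesis using config_three_parallel[OF assms(1)] neq l2 by simp
  next
    case False
    obtain p where p: "line p u1 = line a1 u1" "line p u3 = line a3 u3"
      using lines_meet[OF False] by blast
    obtain q where q: "line q u1 = line a2 u1" "line q u3 = line a3 u3"
      using lines_meet[OF False] by blast
    have "q \<in> line p u3"
      using p q by (metis add.right_neutral line_def rangeI scaleR_zero_left)
    then obtain k where qk: "q = p + k *\<^sub>R u3" by (auto simp: line_def)
    \<comment> \<open>The vector \<open>k *\<^sub>R u3\<close> joins the two crossings on the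
      transversal and takes the role of \<open>v\<close>; it is nonzero because the parallels are
      distinct.\<close>
    have "k \<noteq> 0" using neq(1) p q l2 qk by auto
    then have l3: "line p (k *\<^sub>R u3) = line a3 u3" using p by (simp add: line_scale)
    have "cross2 (k *\<^sub>R u3) u1 = - k * cross2 u1 u3" by (simp add: cross2_def algebra_simps)
    then have "cross2 (k *\<^sub>R u3) u1 \<noteq> 0" using False \<open>k \<noteq> 0\<close> by simp
    from config_two_parallel[OF this, of p]
    have "has_unit_area_config (line a3 u3) (line a2 u2) (line a1 u1)"
      using p q l2 l3 qk by simp
    then show ?thesis
      by (blast intro: has_unit_area_config_swap12 has_unit_area_config_swap23)
  qed
qed

lemma has_unit_area_config_lines:
  assumes "is_line l1" "is_line l2" "is_line l3" and neq: "l1 \<noteq> l2" "l1 \<noteq> l3" "l2 \<noteq> l3"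
  shows "has_unit_area_config l1 l2 l3"
proof -
  obtain a1 u1 a2 u2 a3 u3 where
    u: "u1 \<noteq> 0" "u2 \<noteq> 0" "u3 \<noteq> 0"
    and l: "l1 = line a1 u1" "l2 = line a2 u2" "l3 = line a3 u3"
    using assms is_line_obtains by metis
  \<comment> \<open>Any parallel pair is moved to the first two places by a permutation.\<close>
  consider "cross2 u1 u2 = 0" | "cross2 u1 u3 = 0" | "cross2 u2 u3 = 0"
    | "cross2 u1 u2 \<noteq> 0" "cross2 u1 u3 \<noteq> 0" "cross2 u2 u3 \<noteq> 0" by blast
  then show ?thesis
  proof cases
    case 1
    then show ?thesis using config_parallel_pair u neq unfolding l by blast
  next
    case 2
    then have "has_unit_area_config l1 l3 l2"
      using config_parallel_pair[OF u(1,3,2)] neq unfolding l by metis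
    then show ?thesis by (rule has_unit_area_config_swap23)
  next
    case 3
    then have "has_unit_area_config l2 l3 l1"
      using config_parallel_pair[OF u(2,3,1)] neq unfolding l by metis
    then show ?thesis
      by (blast intro: has_unit_area_config_swap12 has_unit_area_config_swap23)
  next
    case 4
    then show ?thesis unfolding l by (rule config_pairwise_crossing)
  qed
qed

theorem theorem3p1:
  fixes l1 l2 l3 :: "(real^2) set"
  assumes "is_line l1" and "is_line l2" and "is_line l3"
    and "l1 \<noteq> l2" and "l1 \<noteq> l3" and "l2 \<noteq> l3"
  shows "\<exists>c C :: real. 0 < c \<and> 0 < C \<and>
    (\<forall>n::nat. 1 \<le> n \<longrightarrow>
      (\<exists>S1 S2 S3. finite S1 \<and> finite S2 \<and> finite S3 \<and>
         S1 \<subseteq> l1 \<and> S2 \<subseteq> l2 \<and> S3 \<subseteq> l3 \<and>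
         c * real n \<le> real (card S1) \<and> real (card S1) \<le> C * real n \<and>
         c * real n \<le> real (card S2) \<and> real (card S2) \<le> C * real n \<and>
         c * real n \<le> real (card S3) \<and> real (card S3) \<le> C * real n \<and>
         c * (real n)\<^sup>2 \<le> real (card (unit_area_triples S1 S2 S3)) \<and>
         real (card (unit_area_triples S1 S2 S3)) \<le> C * (real n)\<^sup>2))"
  using has_unit_area_config_lines[OF assms] unfolding has_unit_area_config_def .

end
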